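(* For $n\ge 8$ we have $m_3(n,2)=\lfloor n/2\rfloor$, and the unique $n$-vertex triangle-free graph with $\lfloor n/2\rfloor$ maximal independent sets of size $2$ is a comatching of order $n$. Moreover, as $n\to\infty$, $m_3(n,3)=\Theta(n)$ and $m_3(n,4)=\Theta(n^2)$.
   Context: A maximal independent set (MIS) is an independent set maximal with respect to inclusion. $m_3(n,k)$ denotes the maximum number of MIS's of size $k$ in a triangle-free graph on $n$ vertices. A comatching of order $n$ is the complete bipartite graph $K_{\lfloor n/2\rfloor,\lceil n/2\rceil}$ with a matching of size $\lfloor n/2\rfloor$ removed. *)

theory Defs
  imports "Graph_Theory.Graph_Theory" "HOL-Library.Landau_Symbols"
begin

text \<open>
  Finite simple graphs are the \<open>pair_graph\<close>s of the library: finite, loop-free, symmetric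
  sets of arcs, an undirected edge \<open>uv\<close> being the two arcs \<open>(u,v)\<close> and \<open>(v,u)\<close>.
\<close>

definition triangle_free :: "'a pair_pre_digraph \<Rightarrow> bool" where
  "triangle_free G \<longleftrightarrow>
     \<not> (\<exists>x y z. (x, y) \<in> parcs G \<and> (y, z) \<in> parcs G \<and> (z, x) \<in> parcs G)"

definition independent_set :: "'a pair_pre_digraph \<Rightarrow> 'a set \<Rightarrow> bool" where
  "independent_set G S \<longleftrightarrow> S \<subseteq> pverts G \<and> (\<forall>u\<in>S. \<forall>v\<in>S. (u, v) \<notin> parcs G)"

definition maximal_independent_set :: "'a pair_pre_digraph \<Rightarrow> 'a set \<Rightarrow> bool" where
  "maximal_independent_set G S \<longleftrightarrow>
     independent_set G S \<and> (\<forall>T. independent_set G T \<and> S \<subseteq> T \<longrightarrow> T = S)"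

definition num_mis :: "'a pair_pre_digraph \<Rightarrow> nat \<Rightarrow> nat" where
  "num_mis G k = card {S. maximal_independent_set G S \<and> card S = k}"

definition triangle_free_graph :: "nat \<Rightarrow> 'a pair_pre_digraph \<Rightarrow> bool" where
  "triangle_free_graph n G \<longleftrightarrow> pair_graph G \<and> card (pverts G) = n \<and> triangle_free G"

text \<open>
  Natural numbers as vertices are no restriction, as every finite graph has a copy with such
  vertices. The set below is nonempty and bounded by \<open>2 ^ n\<close>, so that \<open>Max\<close> is meaningful.
\<close>

definition m3 :: "nat \<Rightarrow> nat \<Rightarrow> nat" where
  "m3 n k = Max {num_mis G k | G :: nat pair_pre_digraph. triangle_free_graph n G}"

definition matching_of :: "'a pair_pre_digraph \<Rightarrow> 'a set set \<Rightarrow> bool" where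
  "matching_of G M \<longleftrightarrow> M \<subseteq> {{u, v} | u v. (u, v) \<in> parcs G} \<and> pairwise disjnt M"

text \<open>Here \<open>(n + 1) div 2\<close> is the ceiling of \<open>n / 2\<close>.\<close>

definition comatching :: "nat \<Rightarrow> 'a pair_pre_digraph \<Rightarrow> bool" where
  "comatching n G \<longleftrightarrow> (\<exists>(H :: 'a pair_pre_digraph) M.
     complete_bipartite_digraph (n div 2) ((n + 1) div 2) (with_proj H) \<and>
     matching_of H M \<and> card M = n div 2 \<and>
     G = \<lparr> pverts = pverts H, parcs = parcs H - {(u, v). {u, v} \<in> M} \<rparr>)"

end

theory Submission
  imports Defs
begin

text \<open>
  \<open>{u, v}\<close> is a maximal independent set iff \<open>u\<close> and \<open>v\<close> are non-adjacent and dominate the graph.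
  If two such pairs share a vertex, triangle-freeness leaves room for at most three pairs; otherwise
  the pairs form a matching, so there are at most \<open>n div 2\<close>. In that case the neighbourhoods of
  \<open>u\<close> and \<open>v\<close> split the remaining vertices into two independent sets, every other pair crosses this
  bipartition, and domination forces all edges between the sides except those inside the pairs.

  The sets of size 3 through \<open>x\<close> correspond to the dominating pairs among the non-neighbours of \<open>x\<close>.
  When there are more than ten of them, they form a matching and the vertices of different pairs are
  twins. These twin relations at all three vertices of one maximal independent set would create a
  triangle, so every such set has a vertex lying in at most ten of them, and there are at most
  \<open>10 n\<close>. Deleting one vertex with its neighbours gives \<open>10 n\<^sup>2\<close> for size 4. The lower bounds
  come from disjoint unions of two comatchings.
\<close>

section \<open>Dominating pairs\<close>

text \<open>Maximality is encoded as domination of all vertices outside \<open>S\<close>. The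
  relation \<open>E\<close> need not live on \<open>V\<close>, so passing to the non-neighbours of a
  vertex changes the vertex set only and keeps \<open>E\<close>.\<close>

definition mis :: "'a set \<Rightarrow> 'a rel \<Rightarrow> 'a set \<Rightarrow> bool" where
  "mis V E S \<longleftrightarrow> S \<subseteq> V \<and> (\<forall>u\<in>S. \<forall>v\<in>S. (u, v) \<notin> E) \<and> (\<forall>w\<in>V - S. \<exists>u\<in>S. (u, w) \<in> E)"

definition mis_sets :: "'a set \<Rightarrow> 'a rel \<Rightarrow> nat \<Rightarrow> 'a set set" where
  "mis_sets V E k = {S. mis V E S \<and> card S = k}"

definition nonnbrs :: "'a set \<Rightarrow> 'a rel \<Rightarrow> 'a \<Rightarrow> 'a set" where
  "nonnbrs V E x = {w \<in> V. w \<noteq> x \<and> (x, w) \<notin> E}"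

lemma finite_mis_sets: "finite V \<Longrightarrow> finite (mis_sets V E k)"
  by (rule finite_subset[of _ "Pow V"]) (auto simp: mis_sets_def mis_def)

lemma card_mis_sets_le_choose:
  assumes "finite V" shows "card (mis_sets V E k) \<le> card V choose k"
proof -
  have "mis_sets V E k \<subseteq> {S. S \<subseteq> V \<and> card S = k}"
    by (auto simp: mis_sets_def mis_def)
  from card_mono[OF _ this] show ?thesis
    using assms by (simp add: n_subsets)
qed

lemma mis_sets_2D:
  assumes "{u, v} \<in> mis_sets V E 2"
  shows "u \<noteq> v" "u \<in> V" "v \<in> V" "(u, v) \<notin> E" "(v, u) \<notin> E"
    and "\<And>w. w \<in> V \<Longrightarrow> w \<noteq> u \<Longrightarrow> w \<noteq> v \<Longrightarrow> (u, w) \<in> E \<or> (v, w) \<in> E"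
  using assms by (auto simp: mis_sets_def mis_def)

lemma mis_sets_2E:
  assumes "S \<in> mis_sets V E 2" "x \<in> S"
  obtains y where "S = {x, y}"
  using assms unfolding mis_sets_def by (auto simp: card_2_iff doubleton_eq_iff)

locale triangle_free_rel =
  fixes E :: "'a rel"
  assumes sym: "(x, y) \<in> E \<Longrightarrow> (y, x) \<in> E"
    and no_triangle: "(x, y) \<in> E \<Longrightarrow> (y, z) \<in> E \<Longrightarrow> (z, x) \<in> E \<Longrightarrow> False"
begin

lemma irrefl: "(x, x) \<notin> E"
  using no_triangle by blast

text \<open>A vertex outside \<open>S\<close> that is not adjacent to \<open>x\<close> can only be
  dominated from \<open>S - {x}\<close>. This reduces counting sets of one size to counting sets of
  the next smaller size.\<close>

lemma mis_remove_vertex: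
  assumes "S \<in> mis_sets V E (Suc k)" "x \<in> S"
  shows "S - {x} \<in> mis_sets (nonnbrs V E x) E k"
  using assms by (auto simp: mis_sets_def mis_def nonnbrs_def)

text \<open>Since \<open>{u, v}\<close> dominates \<open>w\<close> and \<open>u\<close> does not,
  \<open>vw\<close> is an edge. A further vertex not adjacent to \<open>u\<close> would be adjacent
  to both \<open>v\<close> and \<open>w\<close>; so \<open>u\<close> is adjacent to all of
  \<open>A\<close>, and \<open>A\<close> is independent. As \<open>A\<close> has at least three
  elements, no pair inside \<open>A\<close> dominates the rest of \<open>A\<close>. A dominating
  pair \<open>{x, a}\<close> with \<open>x\<close> in \<open>{v, w}\<close> and \<open>a\<close> in
  \<open>A\<close> makes \<open>x\<close> adjacent to all of \<open>A\<close> but \<open>a\<close>,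
  so \<open>x\<close> determines \<open>a\<close>; if both \<open>v\<close> and \<open>w\<close> had
  such a pair, a third element of \<open>A\<close> would form a triangle with them. Hence at most
  one pair joins \<open>{u, v}\<close> and \<open>{u, w}\<close>.\<close>

lemma mis_pair_shared_vertex_card:
  assumes V: "finite V" "6 \<le> card V"
    and uv: "{u, v} \<in> mis_sets V E 2" and uw: "{u, w} \<in> mis_sets V E 2" and "v \<noteq> w"
  shows "card (mis_sets V E 2) \<le> 3"
proof -
  note uv' = mis_sets_2D[OF uv] and uw' = mis_sets_2D[OF uw]
  define A where "A = V - {u, v, w}"
  have "(v, w) \<in> E" using uv' uw' \<open>v \<noteq> w\<close> by blast
  have Au: "(u, a) \<in> E" if "a \<in> A" for a
    using that uv'(6)[of a] uw'(6)[of a] no_triangle[of v w a] sym \<open>(v, w) \<in> E\<close>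
    unfolding A_def by blast
  have indep: "(a, b) \<notin> E" if "a \<in> A" "b \<in> A" for a b
    using Au that no_triangle sym by blast
  have "card {u, v, w} \<le> 3" by (simp add: card_insert_if)
  moreover have "card V - card {u, v, w} \<le> card A"
    unfolding A_def by (rule diff_card_le_card_Diff) simp
  ultimately have A3: "3 \<le> card A" using V by linarith
  then have finA: "finite A" using card.infinite by fastforce
  have ex: "\<exists>c\<in>A. c \<noteq> a \<and> c \<noteq> b" for a b
  proof (rule ccontr)
    assume "\<not> ?thesis"
    then have "A \<subseteq> {a, b}" by blast
    then have "card A \<le> card {a, b}" by (intro card_mono) auto
    also have "\<dots> \<le> 2" by (simp add: card_insert_if)
    finally show False using A3 by simp
  qed
  have no_AA: "{a, b} \<notin> mis_sets V E 2" if "a \<in> A" "b \<in> A" for a b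
    using ex[of a b] that indep mis_sets_2D(6)[of a b V E] unfolding A_def by blast
  have dom: "(x, c) \<in> E" if "{x, a} \<in> mis_sets V E 2" "a \<in> A" "c \<in> A" "c \<noteq> a" "x \<in> {v, w}" for x a c
    using mis_sets_2D(6)[OF that(1), of c] indep[OF that(2,3)] that unfolding A_def by auto
  have no_vw: False if "{v, a} \<in> mis_sets V E 2" "{w, b} \<in> mis_sets V E 2" "a \<in> A" "b \<in> A" for a b
  proof -
    obtain c where "c \<in> A" "c \<noteq> a" "c \<noteq> b" using ex by blast
    then show False
      using dom[of v a c] dom[of w b c] that no_triangle[of v w c] sym \<open>(v, w) \<in> E\<close> by blast
  qed
  have unique: "a = b" if "{x, a} \<in> mis_sets V E 2" "{x, b} \<in> mis_sets V E 2"
    "a \<in> A" "b \<in> A" "x \<in> {v, w}" for x a b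
    using dom[of x a b] mis_sets_2D(4)[OF that(2)] that by blast
  have cover: "S = {u, v} \<or> S = {u, w} \<or> (\<exists>x\<in>{v, w}. \<exists>a\<in>A. S = {x, a})"
    if S: "S \<in> mis_sets V E 2" for S
  proof -
    obtain p q where pq: "S = {p, q}"
      using S unfolding mis_sets_def by (auto simp: card_2_iff)
    note D = mis_sets_2D[OF S[unfolded pq]]
    have "p \<in> A \<or> p = u \<or> p = v \<or> p = w" "q \<in> A \<or> q = u \<or> q = v \<or> q = w"
      using D(2,3) unfolding A_def by auto
    moreover have "\<not> (p \<in> A \<and> q \<in> A)"
      using no_AA[of p q] S pq by blast
    moreover have "\<not> (p = u \<and> q \<in> A)" "\<not> (q = u \<and> p \<in> A)"
      "\<not> (p = v \<and> q = w)" "\<not> (p = w \<and> q = v)"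
      using D Au \<open>(v, w) \<in> E\<close> by auto
    ultimately have "p = u \<and> (q = v \<or> q = w) \<or> q = u \<and> (p = v \<or> p = w) \<or>
        (p = v \<or> p = w) \<and> q \<in> A \<or> (q = v \<or> q = w) \<and> p \<in> A"
      using D(1) by meson
    then show ?thesis
      unfolding pq by (elim disjE conjE) (auto simp: insert_commute)
  qed
  define R where "R = {S \<in> mis_sets V E 2. \<exists>x\<in>{v, w}. \<exists>a\<in>A. S = {x, a}}"
  have "S = T" if "S \<in> R" "T \<in> R" for S T
    using that no_vw unique unfolding R_def by blast
  then have "R = {} \<or> (\<exists>S. R = {S})" by blast
  then have "card R \<le> 1" by auto
  have "card (mis_sets V E 2) \<le> card ({{u, v}, {u, w}} \<union> R)"
    using finite_mis_sets[OF V(1), of E 2] cover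
    by (intro card_mono) (auto simp: R_def)
  also have "\<dots> \<le> card {{u, v}, {u, w}} + card R"
    by (rule card_Un_le)
  also have "\<dots> \<le> 3"
    using \<open>card R \<le> 1\<close> by (simp add: card_insert_if)
  finally show ?thesis .
qed

lemma mis_pairs_disjoint:
  assumes "finite V" "6 \<le> card V" "4 \<le> card (mis_sets V E 2)"
  shows "pairwise disjnt (mis_sets V E 2)"
proof (rule pairwiseI)
  fix S T assume S: "S \<in> mis_sets V E 2" and T: "T \<in> mis_sets V E 2" and "S \<noteq> T"
  show "disjnt S T"
  proof (rule ccontr)
    assume "\<not> disjnt S T"
    then obtain x where "x \<in> S" "x \<in> T" by (auto simp: disjnt_def)
    then obtain y z where "S = {x, y}" "T = {x, z}"
      using S T by (metis mis_sets_2E)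
    then show False
      using mis_pair_shared_vertex_card[of V x y z] assms S T \<open>S \<noteq> T\<close> by fastforce
  qed
qed

end

section \<open>Families of pairwise disjoint sets\<close>

lemma pairwise_disjnt_pairs_card:
  assumes "finite V" "pairwise disjnt M" "\<And>S. S \<in> M \<Longrightarrow> S \<subseteq> V \<and> card S = 2"
  shows "card M \<le> card V div 2"
proof -
  have "\<And>S. S \<in> M \<Longrightarrow> finite S"
    using assms finite_subset by blast
  then have "card (\<Union>M) = sum card M"
    using assms by (intro card_Union_disjoint) auto
  also have "\<dots> = 2 * card M"
    using assms(3) by simp
  finally have "2 * card M = card (\<Union>M)" by simp
  also have "\<dots> \<le> card V"
    using assms by (intro card_mono) auto
  finally show ?thesis by simp
qed

text \<open>Each element of \<open>F\<close> spoils at most one member of the disjoint family, and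
  \<open>T0\<close> accounts for one more.\<close>

lemma pairwise_disjnt_avoid:
  assumes disj: "pairwise disjnt M" and F: "finite F" "card F + 1 < card M"
  shows "\<exists>T\<in>M. T \<noteq> T0 \<and> T \<inter> F = {}"
proof (rule ccontr)
  assume "\<not> ?thesis"
  then have hit: "T = T0 \<or> T \<inter> F \<noteq> {}" if "T \<in> M" for T
    using that by blast
  \<comment> \<open>\<open>h f\<close> is the only member of \<open>M\<close> containing
    \<open>f\<close>, and arbitrary if there is none. If no member were suitable, \<open>T0\<close>
    and the values of \<open>h\<close> on \<open>F\<close> would exhaust \<open>M\<close>.\<close>
  define h where "h f = (SOME T. T \<in> M \<and> f \<in> T)" for f
  have h: "h f = T" if "T \<in> M" "f \<in> T" for f T
  proof -
    have "h f \<in> M \<and> f \<in> h f"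
      unfolding h_def by (rule someI[of _ T]) (use that in simp)
    with that show ?thesis
      using disj unfolding pairwise_def disjnt_def by blast
  qed
  have "M \<subseteq> insert T0 (h ` F)"
    using hit h by blast
  then have "card M \<le> card (insert T0 (h ` F))"
    using F by (intro card_mono) auto
  also have "\<dots> \<le> Suc (card (h ` F))"
    by (simp add: card_insert_if F)
  also have "\<dots> \<le> Suc (card F)"
    using card_image_le[OF F(1)] by simp
  finally show False using F by simp
qed

section \<open>Number and mutual position of dominating pairs\<close>

context triangle_free_rel
begin

text \<open>Four or more pairs are disjoint, which gives the bound; fewer than four satisfy it
  because \<open>card V div 2\<close> is at least 4.\<close>

lemma card_mis_pairs_le:
  assumes "finite V" "8 \<le> card V"
  shows "card (mis_sets V E 2) \<le> card V div 2"
proof (cases "4 \<le> card (mis_sets V E 2)")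
  case True
  with assms show ?thesis
    by (intro pairwise_disjnt_pairs_card mis_pairs_disjoint) (auto simp: mis_sets_def mis_def)
qed (use assms in simp)

text \<open>Take another pair not containing the common neighbour \<open>x\<close>. One of its
  vertices is adjacent to \<open>x\<close>, and that vertex is itself adjacent to \<open>u\<close>
  or \<open>v\<close>, which closes a triangle with \<open>x\<close>.\<close>

lemma mis_pair_no_common_nbr:
  assumes disj: "pairwise disjnt (mis_sets V E 2)" and "3 \<le> card (mis_sets V E 2)"
    and uv: "{u, v} \<in> mis_sets V E 2" and x: "x \<in> V" and ux: "(u, x) \<in> E" and vx: "(v, x) \<in> E"
  shows False
proof -
  obtain T where T: "T \<in> mis_sets V E 2" "T \<noteq> {u, v}" "x \<notin> T"
    using pairwise_disjnt_avoid[OF disj, of "{x}" "{u, v}"] assms(2) by auto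
  obtain p q where pq: "T = {p, q}"
    using T unfolding mis_sets_def by (auto simp: card_2_iff)
  have "p \<notin> {u, v}" "q \<notin> {u, v}"
    using pairwiseD[OF disj uv T(1)] T(2) pq by (auto simp: disjnt_def)
  moreover note mis_sets_2D[OF T(1)[unfolded pq]] mis_sets_2D(6)[OF uv]
  moreover have "(p, x) \<in> E \<or> (q, x) \<in> E"
    using calculation T(3) pq x by blast
  ultimately show False
    using no_triangle sym ux vx by blast
qed

text \<open>Two dominating pairs are joined by exactly two crossing edges, because each dominates
  the other and neither has a common neighbour. So \<open>u'\<close> corresponds to
  \<open>u\<close>, and the two are twins elsewhere: a neighbour of \<open>u\<close> cannot be
  adjacent to \<open>v'\<close>, so \<open>u'\<close> must dominate it, and likewise with
  \<open>u'\<close> and \<open>v\<close> in place of \<open>u\<close> and \<open>v'\<close>.\<close>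

lemma mis_pair_orientation:
  assumes disj: "pairwise disjnt (mis_sets V E 2)" and 3: "3 \<le> card (mis_sets V E 2)"
    and uv: "{u, v} \<in> mis_sets V E 2" and T: "T \<in> mis_sets V E 2" "T \<noteq> {u, v}"
  obtains u' v' where "T = {u', v'}" "(u', v) \<in> E" "(v', u) \<in> E" "(u', u) \<notin> E" "(v', v) \<notin> E"
    "\<And>w. w \<in> V \<Longrightarrow> w \<notin> {u, v, u', v'} \<Longrightarrow> (w, u) \<in> E \<longleftrightarrow> (w, u') \<in> E"
proof -
  obtain p q where pq: "T = {p, q}"
    using T unfolding mis_sets_def by (auto simp: card_2_iff)
  have ne: "p \<notin> {u, v}" "q \<notin> {u, v}"
    using pairwiseD[OF disj uv T(1)] T(2) pq by (auto simp: disjnt_def)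
  note D = mis_sets_2D[OF uv] and D' = mis_sets_2D[OF T(1)[unfolded pq]]
  \<comment> \<open>The name \<open>u'\<close> goes to an end of \<open>T\<close> that dominates
    \<open>v\<close>.\<close>
  have "\<exists>u' v'. T = {u', v'} \<and> u' \<notin> {u, v} \<and> v' \<notin> {u, v} \<and> (u', v) \<in> E"
    using D D' ne pq by (metis (no_types, lifting) insert_commute insertCI sym)
  then obtain u' v' where T': "T = {u', v'}" "u' \<notin> {u, v}" "v' \<notin> {u, v}" "(u', v) \<in> E"
    by blast
  note D' = mis_sets_2D[OF T(1)[unfolded T'(1)]]
  have nc: "\<And>x. x \<in> V \<Longrightarrow> \<not> ((u, x) \<in> E \<and> (v, x) \<in> E)"
    and nc': "\<And>x. x \<in> V \<Longrightarrow> \<not> ((u', x) \<in> E \<and> (v', x) \<in> E)"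
    using mis_pair_no_common_nbr[OF disj 3] uv T(1) T'(1) by blast+
  have 1: "(u', u) \<notin> E" using nc[of u'] T' D' sym by blast
  have 2: "(v', u) \<in> E" using D'(6)[of u] T' D 1 by auto
  have 3: "(v', v) \<notin> E" using nc[of v'] 2 D' sym by blast
  have "(w, u) \<in> E \<longleftrightarrow> (w, u') \<in> E" if w: "w \<in> V" "w \<notin> {u, v, u', v'}" for w
  proof
    assume "(w, u) \<in> E"
    then have "(v', w) \<notin> E" using 2 no_triangle sym by blast
    then show "(w, u') \<in> E" using D'(6)[of w] w sym by blast
  next
    assume "(w, u') \<in> E"
    then have "(v, w) \<notin> E" using T'(4) no_triangle sym by blast
    then show "(w, u) \<in> E" using D(6)[of w] w sym by blast
  qed
  with T' 1 2 3 show thesis using that by blast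
qed

section \<open>Sets of size three and four\<close>

text \<open>Five vertices have only 10 pairs; this is the origin of the constant 10 in the bounds
  below.\<close>

lemma card_ge_6_if_11_mis_pairs:
  assumes "finite V" "11 \<le> card (mis_sets V E 2)"
  shows "6 \<le> card V"
proof (rule ccontr)
  assume "\<not> ?thesis"
  then have "card V \<in> {0, 1, 2, 3, 4, 5}" by auto
  then have "card V choose 2 \<le> 10" by (auto simp: choose_two)
  then show False
    using card_mis_sets_le_choose[OF assms(1), of E 2] assms(2) by linarith
qed

text \<open>
  Suppose that all three vertices of \<open>S = {x, y, z}\<close> lie in many sets of size 3, and choose further
  ones \<open>{x, y1, z1}\<close>, \<open>{x2, y, z2}\<close> and \<open>{x3, y3, z}\<close>. Among the non-neighbours of \<open>y\<close> the vertices
  \<open>x\<close> and \<open>x2\<close> are twins, so \<open>x2\<close> is adjacent to \<open>y3\<close> because \<open>x\<close> is. Cyclically, \<open>x2\<close>, \<open>y3\<close>, \<open>z1\<close>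
  form a triangle. The twin relation says nothing about the vertices of the two pairs themselves,
  hence the choices avoiding \<open>forb\<close> and \<open>forb'\<close>.
\<close>

lemma mis_triple_has_light_vertex:
  assumes fin: "finite V" and S: "S \<in> mis_sets V E 3"
  shows "\<exists>x\<in>S. card (mis_sets (nonnbrs V E x) E 2) \<le> 10"
proof (rule ccontr)
  assume "\<not> ?thesis"
  then have heavy: "11 \<le> card (mis_sets (nonnbrs V E x) E 2)" if "x \<in> S" for x
    using that by force
  obtain x y z where S_eq: "S = {x, y, z}" and ne: "x \<noteq> y" "y \<noteq> z" "x \<noteq> z"
    using S unfolding mis_sets_def by (auto simp: card_3_iff)
  have disj: "pairwise disjnt (mis_sets (nonnbrs V E w) E 2)" if "w \<in> S" for w
  proof (rule mis_pairs_disjoint)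
    show "finite (nonnbrs V E w)" using fin by (simp add: nonnbrs_def)
    with heavy[OF that] show "6 \<le> card (nonnbrs V E w)"
      by (rule card_ge_6_if_11_mis_pairs[rotated])
    show "4 \<le> card (mis_sets (nonnbrs V E w) E 2)" using heavy[OF that] by simp
  qed
  have pair: "S - {w} \<in> mis_sets (nonnbrs V E w) E 2" if "w \<in> S" for w
    using mis_remove_vertex[of S V 2 w] S that by (simp add: numeral_eq_Suc)
  \<comment> \<open>The pair \<open>{p', q'}\<close> is a second dominating pair among the
    non-neighbours of \<open>c\<close>, with \<open>p'\<close> the twin of \<open>p\<close>.
    Excluding two vertices and the pair \<open>{p, q}\<close> is possible because there are at least
    11 pairs.\<close>
  have shift: "\<exists>p' q'. p' \<in> nonnbrs V E c \<and> q' \<in> nonnbrs V E c \<and> p' \<noteq> forb \<and> q' \<noteq> forb' \<and>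
      (p', q) \<in> E \<and> (q', p) \<in> E \<and> (p', p) \<notin> E \<and> (q', q) \<notin> E \<and>
      (\<forall>w\<in>nonnbrs V E c. w \<notin> {p, q, p', q'} \<longrightarrow> ((w, p) \<in> E \<longleftrightarrow> (w, p') \<in> E))"
    if c: "c \<in> S" and pq: "{p, q} = S - {c}" for c p q forb forb'
  proof -
    define M where "M = mis_sets (nonnbrs V E c) E 2"
    have M: "pairwise disjnt M" "11 \<le> card M" "{p, q} \<in> M"
      using disj[OF c] heavy[OF c] pair[OF c] pq by (auto simp: M_def)
    have "card {forb, forb'} + 1 < card M"
      using M(2) by (simp add: card_insert_if)
    then obtain T where T: "T \<in> M" "T \<noteq> {p, q}" "forb \<notin> T" "forb' \<notin> T"
      using pairwise_disjnt_avoid[OF M(1), of "{forb, forb'}" "{p, q}"] by auto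
    have "3 \<le> card (mis_sets (nonnbrs V E c) E 2)"
      using M(2) unfolding M_def by simp
    from mis_pair_orientation[OF M(1)[unfolded M_def] this M(3)[unfolded M_def]
        T(1)[unfolded M_def] T(2)]
    obtain p' q' where p'q': "T = {p', q'}" "(p', q) \<in> E" "(q', p) \<in> E" "(p', p) \<notin> E" "(q', q) \<notin> E"
      "\<And>w. w \<in> nonnbrs V E c \<Longrightarrow> w \<notin> {p, q, p', q'} \<Longrightarrow> (w, p) \<in> E \<longleftrightarrow> (w, p') \<in> E"
      by metis
    moreover have "p' \<in> nonnbrs V E c" "q' \<in> nonnbrs V E c"
      using mis_sets_2D(2,3)[of p' q'] T(1) p'q'(1) unfolding M_def by blast+
    ultimately show ?thesis using T by blast
  qed
  \<comment> \<open>Each pair is ordered so that its first vertex is the one whose twin becomes a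
    corner of the triangle: \<open>z\<close> for \<open>x\<close>, \<open>x\<close> for
    \<open>y\<close>, \<open>y\<close> for \<open>z\<close>. The three choices are made in this
    order, and each only avoids coincidences with vertices chosen earlier.\<close>
  have "{z, y} = S - {x}" "{x, z} = S - {y}" "{y, x} = S - {z}" "x \<in> S" "y \<in> S" "z \<in> S"
    using S_eq ne by auto
  note shifts = shift[OF this(4,1)] shift[OF this(5,2)] shift[OF this(6,3)]
  obtain y1 z1 where 1: "z1 \<in> nonnbrs V E x" "y1 \<in> nonnbrs V E x"
    "(z1, y) \<in> E" "(y1, z) \<in> E" "(z1, z) \<notin> E" "(y1, y) \<notin> E"
    "\<forall>w\<in>nonnbrs V E x. w \<notin> {z, y, z1, y1} \<longrightarrow> ((w, z) \<in> E \<longleftrightarrow> (w, z1) \<in> E)"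
    using shifts(1) by blast
  obtain z2 x2 where 2: "x2 \<in> nonnbrs V E y" "z2 \<in> nonnbrs V E y" "x2 \<noteq> y1"
    "(x2, z) \<in> E" "(z2, x) \<in> E" "(x2, x) \<notin> E" "(z2, z) \<notin> E"
    "\<forall>w\<in>nonnbrs V E y. w \<notin> {x, z, x2, z2} \<longrightarrow> ((w, x) \<in> E \<longleftrightarrow> (w, x2) \<in> E)"
    using shifts(2)[of y1] by blast
  obtain x3 y3 where 3: "y3 \<in> nonnbrs V E z" "x3 \<in> nonnbrs V E z" "y3 \<noteq> z2" "x3 \<noteq> z1"
    "(y3, x) \<in> E" "(x3, y) \<in> E" "(y3, y) \<notin> E" "(x3, x) \<notin> E"
    "\<forall>w\<in>nonnbrs V E z. w \<notin> {y, x, y3, x3} \<longrightarrow> ((w, y) \<in> E \<longleftrightarrow> (w, y3) \<in> E)"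
    using shifts(3)[of z2 z1] by blast
  have nD: "w \<in> V" "w \<noteq> c" "(w, c) \<notin> E" if "w \<in> nonnbrs V E c" for w c
    using that sym[of w c] unfolding nonnbrs_def by blast+
  have nI: "w \<in> nonnbrs V E c" if "w \<in> V" "w \<noteq> c" "(w, c) \<notin> E" for w c
    using that sym[of c w] unfolding nonnbrs_def by blast
  note n1 = nD[OF 1(1)] and n2 = nD[OF 2(1)] and n3 = nD[OF 3(1)]
  have indep: "(x, y) \<notin> E" "(y, x) \<notin> E" "(y, z) \<notin> E" "(z, y) \<notin> E" "(x, z) \<notin> E" "(z, x) \<notin> E"
    using S unfolding S_eq mis_sets_def mis_def by blast+
  \<comment> \<open>The twin relation needs \<open>y3\<close> outside both pairs. For instance
    \<open>y3\<close> differs from \<open>x2\<close> because \<open>x2\<close> is adjacent to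
    \<open>z\<close> and \<open>y3\<close> is not.\<close>
  have "y3 \<noteq> y" "y3 \<noteq> x" "y3 \<noteq> z" "y3 \<noteq> x2"
    using n3 3(5) 2(4) indep irrefl by metis+
  then have a: "(y3, x2) \<in> E"
    using 2(8) 3(3,5) nI[OF n3(1) _ 3(7)] by blast
  have "z1 \<noteq> z" "z1 \<noteq> y" "z1 \<noteq> x" "z1 \<noteq> y3"
    using n1 1(3) 3(5) indep irrefl by metis+
  then have b: "(z1, y3) \<in> E"
    using 3(9) 3(4) 1(3) nI[OF n1(1) _ 1(5)] by blast
  have "x2 \<noteq> x" "x2 \<noteq> z" "x2 \<noteq> y" "x2 \<noteq> z1"
    using n2 2(4) 1(3) indep irrefl by metis+
  then have c: "(x2, z1) \<in> E"
    using 1(7) 2(3,4) nI[OF n2(1) _ 2(6)] by blast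
  show False using no_triangle a b c by blast
qed

section \<open>Counting through the vertices of the sets\<close>

lemma mis_sets_Int_ne: "S \<in> mis_sets V E (Suc k) \<Longrightarrow> S \<inter> V \<noteq> {}"
  by (auto simp: mis_sets_def mis_def Int_absorb2)

text \<open>Every set is recovered from one of its vertices in \<open>W\<close> and the remaining
  \<open>k\<close> vertices, so a union bound over \<open>W\<close> suffices. For triples
  \<open>W\<close> consists of the light vertices, for quadruples it is all of
  \<open>V\<close>.\<close>

lemma card_mis_le_by_link:
  assumes fin: "finite V" and W: "W \<subseteq> V"
    and link: "\<And>x. x \<in> W \<Longrightarrow> card (mis_sets (nonnbrs V E x) E k) \<le> b"
    and hit: "\<And>S. S \<in> mis_sets V E (Suc k) \<Longrightarrow> S \<inter> W \<noteq> {}"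
  shows "card (mis_sets V E (Suc k)) \<le> b * card V"
proof -
  have finW: "finite W" using fin W finite_subset by blast
  have finN: "finite (nonnbrs V E x)" for x using fin by (simp add: nonnbrs_def)
  have "mis_sets V E (Suc k) \<subseteq> (\<Union>x\<in>W. insert x ` mis_sets (nonnbrs V E x) E k)"
  proof
    fix S assume S: "S \<in> mis_sets V E (Suc k)"
    then obtain x where x: "x \<in> S" "x \<in> W" using hit by blast
    then have "S = insert x (S - {x})" by blast
    with mis_remove_vertex[OF S x(1)] x(2)
    show "S \<in> (\<Union>x\<in>W. insert x ` mis_sets (nonnbrs V E x) E k)" by blast
  qed
  then have "card (mis_sets V E (Suc k)) \<le> card (\<Union>x\<in>W. insert x ` mis_sets (nonnbrs V E x) E k)"
    using finW finN by (intro card_mono) (auto intro: finite_mis_sets)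
  also have "\<dots> \<le> (\<Sum>x\<in>W. card (insert x ` mis_sets (nonnbrs V E x) E k))"
    by (rule card_UN_le[OF finW])
  also have "\<dots> \<le> (\<Sum>x\<in>W. b)"
    by (intro sum_mono order_trans[OF card_image_le link] finite_mis_sets finN)
  also have "\<dots> \<le> b * card V"
    using card_mono[OF fin W] by simp
  finally show ?thesis .
qed

lemma card_mis_triples_le:
  assumes "finite V"
  shows "card (mis_sets V E 3) \<le> 10 * card V"
proof -
  define W where "W = {x \<in> V. card (mis_sets (nonnbrs V E x) E 2) \<le> 10}"
  have "S \<inter> W \<noteq> {}" if S: "S \<in> mis_sets V E (Suc 2)" for S
  proof -
    have "S \<subseteq> V" using S by (simp add: mis_sets_def mis_def)
    then show ?thesis
      using mis_triple_has_light_vertex[OF assms, of S] S by (auto simp: W_def numeral_eq_Suc)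
  qed
  then have "card (mis_sets V E (Suc 2)) \<le> 10 * card V"
    by (intro card_mis_le_by_link[OF assms, of W]) (auto simp: W_def)
  then show ?thesis by (simp add: numeral_eq_Suc)
qed

lemma card_mis_quadruples_le:
  assumes "finite V"
  shows "card (mis_sets V E 4) \<le> 10 * (card V)\<^sup>2"
proof -
  have "card (mis_sets (nonnbrs V E x) E 3) \<le> 10 * card V" for x
    using card_mis_triples_le[of "nonnbrs V E x"] assms card_mono[of V "nonnbrs V E x"]
    by (auto simp: nonnbrs_def)
  then have "card (mis_sets V E (Suc 3)) \<le> 10 * card V * card V"
    using assms mis_sets_Int_ne by (intro card_mis_le_by_link[of V V]) blast+
  then show ?thesis by (simp add: power2_eq_square)
qed

end

section \<open>Extremal graphs\<close>

text \<open>
  A standard comatching on \<open>{..<n}\<close>: the parity classes are the sides, and the removed matching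
  consists of the pairs \<open>{2 i, 2 i + 1}\<close>. For odd \<open>n\<close> the last vertex is left unmatched.
\<close>

definition comatched :: "nat \<Rightarrow> nat \<Rightarrow> bool" where
  "comatched i j \<longleftrightarrow> even i \<noteq> even j \<and> i div 2 \<noteq> j div 2"

text \<open>Common coordinates for the extremal graphs: a labelling yields the comatching structure,
  and two labellings compose to an isomorphism.\<close>

definition comatching_labelling :: "nat \<Rightarrow> 'a set \<Rightarrow> 'a rel \<Rightarrow> (nat \<Rightarrow> 'a) \<Rightarrow> bool" where
  "comatching_labelling n V E g \<longleftrightarrow>
     bij_betw g {..<n} V \<and> (\<forall>i<n. \<forall>j<n. (g i, g j) \<in> E \<longleftrightarrow> comatched i j)"

text \<open>Serves to number the larger side: first its vertices lying in pairs, in the order of the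
  pairs, then the vertex left over when \<open>n\<close> is odd.\<close>

lemma extend_bij_betw:
  assumes "finite A" "inj_on a {..<m}" "a ` {..<m} \<subseteq> A"
  obtains f where "bij_betw f {..<card A} A" "\<And>i. i < m \<Longrightarrow> f i = a i"
proof -
  let ?R = "A - a ` {..<m}"
  have card_a: "card (a ` {..<m}) = m" using assms(2) by (simp add: card_image)
  have le: "m \<le> card A"
    using card_mono[OF assms(1,3)] card_a by simp
  have "card ?R = card {m..<card A}"
    using assms card_a by (simp add: card_Diff_subset)
  then obtain r where r: "bij_betw r {m..<card A} ?R"
    using finite_same_card_bij[of "{m..<card A}" ?R] assms(1) by auto
  define f where "f i = (if i < m then a i else r i)" for i
  have "bij_betw f {..<m} (a ` {..<m})"
    using assms(2) by (auto simp: bij_betw_def f_def inj_on_def)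
  moreover have "bij_betw f {m..<card A} ?R"
    using r by (subst bij_betw_cong[of _ _ r]) (auto simp: f_def)
  ultimately have "bij_betw f ({..<m} \<union> {m..<card A}) (a ` {..<m} \<union> ?R)"
    by (rule bij_betw_combine) auto
  moreover have "{..<m} \<union> {m..<card A} = {..<card A}" "a ` {..<m} \<union> ?R = A"
    using le assms(3) by auto
  ultimately show thesis using that[of f] by (simp add: f_def)
qed

context triangle_free_rel
begin

lemma extremal_comatching_labelling:
  assumes fin: "finite V" and n8: "8 \<le> card V"
    and ext: "card (mis_sets V E 2) = card V div 2"
  shows "\<exists>g. comatching_labelling (card V) V E g"
proof -
  define n m M where "n = card V" and "m = n div 2" and "M = mis_sets V E 2"
  have m4: "4 \<le> m" and cM: "card M = m" using n8 ext by (auto simp: n_def m_def M_def)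
  have disj: "pairwise disjnt M"
    unfolding M_def by (rule mis_pairs_disjoint[OF fin]) (use n8 ext in auto)
  have M3: "3 \<le> card M" using m4 cM by simp
  \<comment> \<open>The side opposite to \<open>p\<close>: its neighbours together with its partner
    \<open>q\<close>, which \<open>p\<close> misses only because the edge between them is the
    removed one.\<close>
  define side where "side p q = insert q {w \<in> V. (w, p) \<in> E}" for p q
  obtain S where "S \<in> M" using cM m4 by fastforce
  then obtain p q where "{p, q} \<in> M"
    unfolding M_def mis_sets_def by (auto simp: card_2_iff)
  \<comment> \<open>The names are chosen so that \<open>B\<close>, defined next, is not the larger
    side.\<close>
  then obtain u v where uv: "{u, v} \<in> M" and small: "card (side v u) \<le> card (side u v)"
    by (metis insert_commute nle_le)
  define A B where "A = side u v" and "B = side v u"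
  note D = mis_sets_2D[OF uv[unfolded M_def]]
  have nc: "\<not> ((u, x) \<in> E \<and> (v, x) \<in> E)" if "x \<in> V" for x
    using mis_pair_no_common_nbr[OF disj[unfolded M_def] M3[unfolded M_def] uv[unfolded M_def] that]
    by blast
  have AB: "A \<union> B = V" "A \<inter> B = {}"
  proof -
    have "x \<in> A \<or> x \<in> B" if "x \<in> V" for x
      using D(6)[OF that] that sym unfolding A_def B_def side_def by blast
    then show "A \<union> B = V"
      using D(2,3) unfolding A_def B_def side_def by blast
    show "A \<inter> B = {}"
      using nc D(1,4,5) sym irrefl unfolding A_def B_def side_def by blast
  qed
  \<comment> \<open>Two neighbours of \<open>s\<close> are non-adjacent by triangle-freeness, and
    \<open>t\<close> is not adjacent to a neighbour of \<open>s\<close> because \<open>s\<close> and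
    \<open>t\<close> have no common neighbour.\<close>
  have indep: "(x, y) \<notin> E" if "x \<in> side s t" "y \<in> side s t" "{s, t} = {u, v}" for x y s t
  proof -
    have "\<not> ((s, z) \<in> E \<and> (t, z) \<in> E)" if "z \<in> V" for z
      using nc[OF that] \<open>{s, t} = {u, v}\<close> by (auto simp: doubleton_eq_iff)
    then show ?thesis
      using that(1,2) no_triangle[of x y s] sym irrefl unfolding side_def by blast
  qed
  have indepA: "(x, y) \<notin> E" if "x \<in> A" "y \<in> A" for x y
    using indep[of x u v y] that unfolding A_def by blast
  have split: "\<exists>a b. T = {a, b} \<and> a \<in> A \<and> b \<in> B" if T: "T \<in> M" for T
  proof (cases "T = {u, v}")
    case True
    then show ?thesis unfolding A_def B_def side_def by blast
  next
    case False
    from mis_pair_orientation[OF disj[unfolded M_def] M3[unfolded M_def] uv[unfolded M_def]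
        T[unfolded M_def] False]
    obtain u' v' where "T = {u', v'}" "(u', v) \<in> E" "(v', u) \<in> E" by metis
    moreover from this have "u' \<in> V" "v' \<in> V"
      using mis_sets_2D(2,3)[of u' v'] T unfolding M_def by blast+
    ultimately show ?thesis unfolding A_def B_def side_def by blast
  qed
  obtain e where e: "bij_betw e {..<m} M"
    using ex_bij_betw_nat_finite[OF finite_mis_sets[OF fin], of E 2] cM
    unfolding M_def by (auto simp: atLeast0LessThan)
  then have eM: "e i \<in> M" if "i < m" for i
    using that by (auto simp: bij_betw_def)
  then have "\<forall>i. \<exists>a b. i < m \<longrightarrow> e i = {a, b} \<and> a \<in> A \<and> b \<in> B"
    using split by blast
  then obtain a b where ab: "e i = {a i, b i}" "a i \<in> A" "b i \<in> B" if "i < m" for i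
    by metis
  have inter: "i = j" if "i < m" "j < m" "e i \<inter> e j \<noteq> {}" for i j
  proof -
    have "e i = e j"
      using disj eM[OF that(1)] eM[OF that(2)] that(3) unfolding pairwise_def disjnt_def by blast
    then show ?thesis using e that unfolding bij_betw_def inj_on_def by blast
  qed
  have inj_a: "inj_on a {..<m}" and inj_b: "inj_on b {..<m}"
    using inter ab(1) unfolding inj_on_def by (metis IntI empty_iff insertCI lessThan_iff)+
  have finA: "finite A" and finB: "finite B" using AB fin by (auto intro: finite_subset)
  have cAB: "card A + card B = n"
    unfolding n_def AB(1)[symmetric] using card_Un_disjoint[OF finA finB AB(2)] by simp
  have "a ` {..<m} \<subseteq> A" "b ` {..<m} \<subseteq> B" using ab by auto
  \<comment> \<open>Each of the \<open>m\<close> pairs has its own vertex in \<open>B\<close>, and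
    \<open>B\<close> has at most half of the vertices. So \<open>B\<close> consists exactly of the
    vertices \<open>b i\<close>, and only \<open>A\<close> can contain an unpaired vertex.\<close>
  then have "m \<le> card B"
    using card_inj_on_le[OF inj_b _ finB] by simp
  then have cB: "card B = m" and cA: "card A = n - m"
    using cAB small unfolding A_def[symmetric] B_def[symmetric] m_def by linarith+
  have bB: "b ` {..<m} = B"
    using card_subset_eq[OF finB \<open>b ` {..<m} \<subseteq> B\<close>] cB card_image[OF inj_b] by simp
  obtain f where f: "bij_betw f {..<n - m} A" "\<And>i. i < m \<Longrightarrow> f i = a i"
    using extend_bij_betw[OF finA inj_a \<open>a ` {..<m} \<subseteq> A\<close>] cA by metis
  have fA: "f i \<in> A" if "i < n - m" for i using f(1) that by (auto simp: bij_betw_def)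
  \<comment> \<open>The pair \<open>{a j, b j}\<close> has to dominate \<open>f i\<close>; since
    \<open>a j\<close> lies on the same side as \<open>f i\<close>, only \<open>b j\<close> can do
    so.\<close>
  have adj: "(f i, b j) \<in> E \<longleftrightarrow> i \<noteq> j" if i: "i < n - m" and j: "j < m" for i j
  proof -
    have T: "{a j, b j} \<in> mis_sets V E 2" using eM[OF j] ab(1)[OF j] unfolding M_def by simp
    note D' = mis_sets_2D[OF T]
    show ?thesis
    proof
      show "i \<noteq> j" if "(f i, b j) \<in> E" using that D' f(2)[OF j] by metis
    next
      assume "i \<noteq> j"
      moreover have "j < n - m" using j unfolding m_def by linarith
      ultimately have "f i \<noteq> a j"
        using inj_on_eq_iff[OF bij_betw_imp_inj_on[OF f(1)], of i j] f(2)[OF j] i by simp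
      moreover have "f i \<noteq> b j" using fA[OF i] ab(3)[OF j] AB(2) by (metis disjoint_iff)
      moreover have "f i \<in> V" using fA[OF i] AB(1) by blast
      ultimately have "(a j, f i) \<in> E \<or> (b j, f i) \<in> E" using D'(6) by metis
      then show "(f i, b j) \<in> E" using indepA[OF ab(2)[OF j] fA[OF i]] sym by metis
    qed
  qed
  have indepB: "(x, y) \<notin> E" if "x \<in> B" "y \<in> B" for x y
    using indep[of x v u y] that unfolding B_def by blast
  \<comment> \<open>Even labels number \<open>A\<close>, odd ones \<open>B\<close>, and pair
    \<open>i\<close> gets the labels \<open>2 * i\<close> and \<open>2 * i + 1\<close>. For odd
    \<open>n\<close> the last label \<open>2 * m\<close> is even and falls to the unpaired vertex of
    \<open>A\<close>.\<close>
  define g where "g k = (if even k then f (k div 2) else b (k div 2))" for k :: nat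
  have gA: "g k \<in> A" "k div 2 < n - m" if "even k" "k < n" for k
  proof -
    show "k div 2 < n - m" using that by (auto elim!: evenE simp: m_def)
    then show "g k \<in> A" using fA that unfolding g_def by simp
  qed
  have gB: "g k \<in> B" "k div 2 < m" if "odd k" "k < n" for k
  proof -
    show "k div 2 < m" using that by (auto elim!: oddE simp: m_def)
    then show "g k \<in> B" using ab(3) that unfolding g_def by simp
  qed
  have "bij_betw g {..<n} V"
  proof (rule bij_betwI')
    fix k l assume kl: "k \<in> {..<n}" "l \<in> {..<n}"
    show "g k = g l \<longleftrightarrow> k = l"
    proof
      assume eq: "g k = g l"
      then have par: "even k = even l"
        using gA(1)[of k] gB(1)[of k] gA(1)[of l] gB(1)[of l] kl AB(2)
        by (metis disjoint_iff lessThan_iff)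
      have "k div 2 = l div 2"
      proof (cases "even k")
        case True
        then show ?thesis
          using eq par gA(2)[of k] gA(2)[of l] kl f(1) unfolding g_def bij_betw_def inj_on_def by simp
      next
        case False
        then show ?thesis
          using eq par gB(2)[of k] gB(2)[of l] kl inj_b unfolding g_def inj_on_def by simp
      qed
      with par show "k = l" by presburger
    qed simp
  next
    fix k assume "k \<in> {..<n}"
    then show "g k \<in> V" using gA[of k] gB[of k] AB(1) by blast
  next
    fix w assume "w \<in> V"
    then consider "w \<in> A" | "w \<in> B" using AB(1) by blast
    then show "\<exists>k\<in>{..<n}. w = g k"
    proof cases
      case 1
      then obtain i where "i < n - m" "w = f i" using f(1) by (auto simp: bij_betw_def)
      then have "2 * i < n" "w = g (2 * i)" by (auto simp: g_def m_def)
      then show ?thesis by blast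
    next
      case 2
      then obtain i where "i < m" "w = b i" using bB by auto
      then have "2 * i + 1 < n" "w = g (2 * i + 1)" by (auto simp: g_def m_def)
      then show ?thesis by blast
    qed
  qed
  moreover have "(g i, g j) \<in> E \<longleftrightarrow> comatched i j" if ij: "i < n" "j < n" for i j
  proof (cases "even i = even j")
    case True
    then show ?thesis
      using gA[of i] gB[of i] gA[of j] gB[of j] ij indepA indepB by (auto simp: comatched_def)
  next
    case False
    show ?thesis
    proof (cases "even i")
      case True
      with False show ?thesis
        using adj[of "i div 2" "j div 2"] gA(2)[of i] gB(2)[of j] ij
        by (simp add: comatched_def g_def)
    next
      case odd: False
      with False show ?thesis
        using adj[of "j div 2" "i div 2"] gA(2)[of j] gB(2)[of i] ij
          sym[of "g i" "g j"] sym[of "g j" "g i"]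
        by (auto simp: comatched_def g_def)
    qed
  qed
  ultimately show ?thesis unfolding comatching_labelling_def n_def[symmetric] by blast
qed

end

section \<open>From labellings to comatchings and isomorphisms\<close>

lemma comatching_labelling_imp_comatching:
  assumes G: "pair_graph G" and lab: "comatching_labelling n (pverts G) (parcs G) g"
  shows "comatching n G"
proof -
  interpret pair_graph G by (rule G)
  \<comment> \<open>Below \<open>n\<close> there are \<open>n div 2\<close> odd and
    \<open>(n + 1) div 2\<close> even labels, so the odd ones form the side of size
    \<open>n div 2\<close>.\<close>
  define odds evens where "odds = (\<lambda>i. g (2 * i + 1)) ` {..<n div 2}"
    and "evens = (\<lambda>i. g (2 * i)) ` {..<(n + 1) div 2}"
  have inj: "g i = g j \<longleftrightarrow> i = j" if "i < n" "j < n" for i j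
    using lab that unfolding comatching_labelling_def bij_betw_def inj_on_def by blast
  have V: "pverts G = g ` {..<n}"
    using lab unfolding comatching_labelling_def bij_betw_def by blast
  have adj: "(g i, g j) \<in> parcs G \<longleftrightarrow> comatched i j" if "i < n" "j < n" for i j
    using lab that unfolding comatching_labelling_def by blast
  have odds: "odds = g ` {i. i < n \<and> odd i}"
  proof -
    have "{i. i < n \<and> odd i} = (\<lambda>i. 2 * i + 1) ` {..<n div 2}"
      by (auto elim!: oddE)
    then show ?thesis unfolding odds_def by (simp add: image_image)
  qed
  have evens: "evens = g ` {i. i < n \<and> even i}"
  proof -
    have "{i. i < n \<and> even i} = (\<lambda>i. 2 * i) ` {..<(n + 1) div 2}"
      by (auto elim!: evenE)
    then show ?thesis unfolding evens_def by (simp add: image_image)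
  qed
  \<comment> \<open>\<open>H\<close> restores the missing edges between the sides, and
    \<open>M\<close> below is the matching that has to be removed again.\<close>
  define H where "H = \<lparr> pverts = pverts G, parcs = odds \<times> evens \<union> evens \<times> odds \<rparr>"
  define M where "M = (\<lambda>i. {g (2 * i), g (2 * i + 1)}) ` {..<n div 2}"
  have "card odds = n div 2"
    unfolding odds_def by (subst card_image) (auto simp: inj_on_def inj)
  moreover have "card evens = (n + 1) div 2"
    unfolding evens_def by (subst card_image) (auto simp: inj_on_def inj)
  moreover have "pverts G = odds \<union> evens"
    unfolding V odds evens by blast
  moreover have "odds \<inter> evens = {}"
    unfolding odds evens using inj by auto
  ultimately have "complete_bipartite_digraph (n div 2) ((n + 1) div 2) (with_proj H)"
    unfolding complete_bipartite_digraph_pair_def H_def using pair_finite_verts by auto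
  moreover have "matching_of H M"
    unfolding matching_of_def
  proof
    show "M \<subseteq> {{u, v} |u v. (u, v) \<in> parcs H}"
    proof
      fix T assume "T \<in> M"
      then obtain i where i: "i < n div 2" "T = {g (2 * i), g (2 * i + 1)}" by (auto simp: M_def)
      then have "(g (2 * i), g (2 * i + 1)) \<in> parcs H"
        unfolding H_def evens_def odds_def by auto
      with i show "T \<in> {{u, v} |u v. (u, v) \<in> parcs H}" by blast
    qed
    show "pairwise disjnt M"
    proof (rule pairwiseI)
      fix S T assume "S \<in> M" "T \<in> M" "S \<noteq> T"
      then obtain i j where ij: "i < n div 2" "j < n div 2" "i \<noteq> j"
        and ST: "S = {g (2 * i), g (2 * i + 1)}" "T = {g (2 * j), g (2 * j + 1)}"
        unfolding M_def by blast
      have "2 * i \<noteq> 2 * j + 1" "2 * i + 1 \<noteq> 2 * j" by presburger+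
      with ij show "disjnt S T" unfolding ST disjnt_def by (simp add: inj)
    qed
  qed
  moreover have "card M = n div 2"
  proof -
    have "inj_on (\<lambda>i. {g (2 * i), g (2 * i + 1)}) {..<n div 2}"
      by (rule inj_onI) (auto simp: doubleton_eq_iff inj)
    then show ?thesis unfolding M_def by (simp add: card_image)
  qed
  moreover have "parcs G = parcs H - {(u, v). {u, v} \<in> M}"
  proof -
    have M_iff: "{g i, g j} \<in> M \<longleftrightarrow> i div 2 = j div 2" if "i < n" "j < n" "even i \<noteq> even j" for i j
    proof
      assume "{g i, g j} \<in> M"
      then obtain k where "k < n div 2" "{g i, g j} = {g (2 * k), g (2 * k + 1)}"
        by (auto simp: M_def)
      then show "i div 2 = j div 2" using that inj by (auto simp: doubleton_eq_iff)
    next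
      assume "i div 2 = j div 2"
      with that have "{i, j} = {2 * (i div 2), 2 * (i div 2) + 1}" "i div 2 < n div 2"
        by (cases "even i"; cases "even j"; auto elim!: evenE oddE)+
      then have "{g i, g j} = {g (2 * (i div 2)), g (2 * (i div 2) + 1)}"
        by (metis image_empty image_insert)
      with \<open>i div 2 < n div 2\<close> show "{g i, g j} \<in> M" unfolding M_def by blast
    qed
    have H_iff: "(g i, g j) \<in> parcs H \<longleftrightarrow> even i \<noteq> even j" if "i < n" "j < n" for i j
      using that inj unfolding H_def odds evens by auto
    have "(x, y) \<in> parcs G \<longleftrightarrow> (x, y) \<in> parcs H - {(u, v). {u, v} \<in> M}" for x y
    proof (cases "x \<in> pverts G \<and> y \<in> pverts G")
      case True
      then obtain i j where "i < n" "j < n" "x = g i" "y = g j" unfolding V by auto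
      then show ?thesis using adj H_iff M_iff by (auto simp: comatched_def)
    next
      case False
      then show ?thesis
        using in_arcsD1 in_arcsD2 \<open>pverts G = odds \<union> evens\<close> unfolding H_def by auto
    qed
    then show ?thesis by auto
  qed
  ultimately show ?thesis
    unfolding comatching_def
    by (intro exI[of _ H] exI[of _ M]) (simp add: H_def)
qed

text \<open>The map sending the vertex labelled \<open>i\<close> by \<open>g\<close> to the vertex
  labelled \<open>i\<close> by \<open>h\<close> preserves adjacency, since adjacency depends on the
  labels alone.\<close>

lemma comatching_labelling_iso:
  assumes G: "pair_graph G" and H: "pair_graph H"
    and g: "comatching_labelling n (pverts G) (parcs G) g"
    and h: "comatching_labelling n (pverts H) (parcs H) h"
  shows "digraph_iso (with_proj G) (with_proj H)"
proof -
  interpret G: pair_graph G by (rule G)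
  interpret H: pair_graph H by (rule H)
  define \<phi> where "\<phi> x = h (the_inv_into {..<n} g x)" for x
  have bg: "bij_betw g {..<n} (pverts G)" and bh: "bij_betw h {..<n} (pverts H)"
    using g h unfolding comatching_labelling_def by blast+
  have \<phi>g: "\<phi> (g i) = h i" if "i < n" for i
    using that bg unfolding \<phi>_def bij_betw_def by (simp add: the_inv_into_f_f)
  have b\<phi>: "bij_betw \<phi> (pverts G) (pverts H)"
    unfolding \<phi>_def using bij_betw_trans[OF bij_betw_the_inv_into[OF bg] bh] by (simp add: comp_def)
  have \<phi>_adj: "(\<phi> x, \<phi> y) \<in> parcs H \<longleftrightarrow> (x, y) \<in> parcs G" if xy: "x \<in> pverts G" "y \<in> pverts G" for x y
  proof -
    obtain i j where "i < n" "j < n" "x = g i" "y = g j"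
      using xy bg unfolding bij_betw_def by (metis imageE lessThan_iff)
    then show ?thesis using g h \<phi>g unfolding comatching_labelling_def by simp
  qed
  have arcs: "map_prod \<phi> \<phi> ` parcs G = parcs H"
  proof
    show "map_prod \<phi> \<phi> ` parcs G \<subseteq> parcs H"
      using \<phi>_adj G.in_arcsD1 G.in_arcsD2 by fastforce
    show "parcs H \<subseteq> map_prod \<phi> \<phi> ` parcs G"
    proof
      fix e assume e: "e \<in> parcs H"
      then have "fst e \<in> \<phi> ` pverts G" "snd e \<in> \<phi> ` pverts G"
        using b\<phi> H.arc_fst_in_verts H.arc_snd_in_verts unfolding bij_betw_def by auto
      then obtain x y where "x \<in> pverts G" "y \<in> pverts G" "e = (\<phi> x, \<phi> y)"
        by (metis imageE prod.collapse)
      with e \<phi>_adj show "e \<in> map_prod \<phi> \<phi> ` parcs G" by force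
    qed
  qed
  define f where "f = \<lparr> iso_verts = \<phi>, iso_arcs = map_prod \<phi> \<phi>, iso_head = snd, iso_tail = fst \<rparr>"
  have "inj_on (map_prod \<phi> \<phi>) (parcs G)"
  proof (rule inj_on_subset)
    show "inj_on (map_prod \<phi> \<phi>) (pverts G \<times> pverts G)"
      using b\<phi> unfolding bij_betw_def by (intro map_prod_inj_on) auto
    show "parcs G \<subseteq> pverts G \<times> pverts G"
      using G.in_arcsD1 G.in_arcsD2 by auto
  qed
  then have "pre_digraph.digraph_isomorphism (with_proj G) f"
    unfolding pre_digraph.digraph_isomorphism_def
    using b\<phi> G.wf_digraph_axioms by (simp add: f_def bij_betw_def)
  moreover have "with_proj H = app_iso f (with_proj G)"
    using b\<phi> arcs by (simp add: app_iso_def f_def with_proj_def bij_betw_def)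
  ultimately show ?thesis unfolding digraph_iso_def by blast
qed

section \<open>Graphs and their numbers of maximal independent sets\<close>

text \<open>An undominated vertex could be added to an independent set, so inclusion-maximality and
  domination agree.\<close>

lemma num_mis_eq_card_mis_sets:
  assumes "pair_graph G"
  shows "num_mis G k = card (mis_sets (pverts G) (parcs G) k)"
proof -
  interpret pair_graph G by (rule assms)
  have sym: "(v, u) \<in> parcs G" if "(u, v) \<in> parcs G" for u v
    using pair_sym_arcs that by (auto simp: symmetric_def dest: symD)
  have loop: "(u, u) \<notin> parcs G" for u
    using pair_no_loops by fastforce
  have "maximal_independent_set G S \<longleftrightarrow> mis (pverts G) (parcs G) S" for S
  proof
    assume S: "maximal_independent_set G S"
    then have ind: "independent_set G S"
      and max: "\<And>T. independent_set G T \<Longrightarrow> S \<subseteq> T \<Longrightarrow> T = S"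
      unfolding maximal_independent_set_def by blast+
    have "\<exists>u\<in>S. (u, w) \<in> parcs G" if w: "w \<in> pverts G - S" for w
    proof (rule ccontr)
      assume "\<not> ?thesis"
      then have "independent_set G (insert w S)"
        using ind w sym loop unfolding independent_set_def by blast
      with max[of "insert w S"] w show False by blast
    qed
    with ind show "mis (pverts G) (parcs G) S"
      unfolding mis_def independent_set_def by blast
  next
    assume "mis (pverts G) (parcs G) S"
    then show "maximal_independent_set G S"
      unfolding maximal_independent_set_def independent_set_def mis_def by blast
  qed
  then show ?thesis by (simp add: num_mis_def mis_sets_def)
qed

lemma triangle_free_graphD:
  assumes "triangle_free_graph n G"
  shows "pair_graph G" "card (pverts G) = n" "finite (pverts G)" "triangle_free_rel (parcs G)"
    "num_mis G k = card (mis_sets (pverts G) (parcs G) k)"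
proof -
  show G: "pair_graph G" and "card (pverts G) = n"
    using assms by (auto simp: triangle_free_graph_def)
  interpret pair_graph G by (rule G)
  show "finite (pverts G)" by (rule pair_finite_verts)
  show "triangle_free_rel (parcs G)"
  proof
    show "(y, x) \<in> parcs G" if "(x, y) \<in> parcs G" for x y
      using pair_sym_arcs that by (auto simp: symmetric_def dest: symD)
    show False if "(x, y) \<in> parcs G" "(y, z) \<in> parcs G" "(z, x) \<in> parcs G" for x y z
      using assms that unfolding triangle_free_graph_def triangle_free_def by blast
  qed
  show "num_mis G k = card (mis_sets (pverts G) (parcs G) k)"
    by (rule num_mis_eq_card_mis_sets[OF G])
qed

section \<open>Comatchings are extremal\<close>

lemma comatchingE:
  assumes "comatching n G"
  obtains U W M where "finite U" "finite W" "U \<inter> W = {}" "card U = n div 2"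
    "card W = (n + 1) div 2" "pverts G = U \<union> W" "pairwise disjnt M" "card M = n div 2"
    "\<And>T. T \<in> M \<Longrightarrow> \<exists>u\<in>U. \<exists>w\<in>W. T = {u, w}"
    "parcs G = (U \<times> W \<union> W \<times> U) - {(u, v). {u, v} \<in> M}"
proof -
  obtain H :: "'a pair_pre_digraph" and M where
    H: "complete_bipartite_digraph (n div 2) ((n + 1) div 2) (with_proj H)"
    and M: "matching_of H M" "card M = n div 2"
    and G: "G = \<lparr> pverts = pverts H, parcs = parcs H - {(u, v). {u, v} \<in> M} \<rparr>"
    using assms unfolding comatching_def by blast
  from H obtain U W where fin: "finite (pverts H)" and UW: "pverts H = U \<union> W" "U \<inter> W = {}"
    "card U = n div 2" "card W = (n + 1) div 2" "parcs H = U \<times> W \<union> W \<times> U"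
    unfolding complete_bipartite_digraph_pair_def by blast
  have "\<exists>u\<in>U. \<exists>w\<in>W. T = {u, w}" if "T \<in> M" for T
    using M(1) that unfolding matching_of_def UW(5) by fastforce
  moreover have "pairwise disjnt M" using M(1) by (simp add: matching_of_def)
  ultimately show thesis
    using that[of U W M] fin UW M(2) G by simp
qed

lemma comatching_imp_triangle_free_graph:
  assumes "comatching n G"
  shows "triangle_free_graph n G"
proof -
  obtain U W M where UW: "finite U" "finite W" "U \<inter> W = {}" "card U = n div 2"
    "card W = (n + 1) div 2" "pverts G = U \<union> W"
    and arcs: "parcs G = (U \<times> W \<union> W \<times> U) - {(u, v). {u, v} \<in> M}"
    by (rule comatchingE[OF assms]) (rule that)
  have "pair_graph G"
  proof
    show "finite (pverts G)" "finite (parcs G)" using UW arcs by auto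
    show "symmetric (with_proj G)"
      using arcs by (auto simp: symmetric_def insert_commute intro!: symI)
  next
    fix e assume "e \<in> parcs G"
    then have "fst e \<in> U \<and> snd e \<in> W \<or> fst e \<in> W \<and> snd e \<in> U"
      unfolding arcs by auto
    then show "fst e \<in> pverts G" "snd e \<in> pverts G" "fst e \<noteq> snd e"
      unfolding UW(6) using UW(3) by (blast, blast, metis disjoint_iff)
  qed
  moreover have "card (pverts G) = n"
    using UW by (simp add: card_Un_disjoint)
  moreover have "triangle_free G"
    using UW(3) unfolding triangle_free_def arcs by blast
  ultimately show ?thesis by (simp add: triangle_free_graph_def)
qed

text \<open>A vertex misses at most its partner on the other side, so the \<open>n div 2\<close>
  removed edges are dominating pairs. That there are no others follows from the general upper
  bound.\<close>

lemma comatching_num_mis: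
  assumes "comatching n G" "8 \<le> n"
  shows "num_mis G 2 = n div 2"
proof -
  obtain U W M where UW: "finite U" "finite W" "U \<inter> W = {}" "card U = n div 2"
    "card W = (n + 1) div 2" "pverts G = U \<union> W"
    and M: "pairwise disjnt M" "card M = n div 2" "\<And>T. T \<in> M \<Longrightarrow> \<exists>u\<in>U. \<exists>w\<in>W. T = {u, w}"
    and arcs: "parcs G = (U \<times> W \<union> W \<times> U) - {(u, v). {u, v} \<in> M}"
    by (rule comatchingE[OF assms(1)]) (rule that)
  note G = triangle_free_graphD[OF comatching_imp_triangle_free_graph[OF assms(1)]]
  interpret triangle_free_rel "parcs G" by (rule G)
  have "M \<subseteq> mis_sets (pverts G) (parcs G) 2"
  proof
    fix T assume T: "T \<in> M"
    then obtain u w where uw: "u \<in> U" "w \<in> W" "T = {u, w}" using M(3) by blast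
    have uniq: "S = T" if "S \<in> M" "S \<inter> T \<noteq> {}" for S
      using M(1) T that unfolding pairwise_def disjnt_def by blast
    have "(u, x) \<in> parcs G" if "x \<in> W" "x \<noteq> w" for x
    proof -
      have "{u, x} \<notin> M" using uniq[of "{u, x}"] uw that by (auto simp: doubleton_eq_iff)
      then show ?thesis using uw that arcs by auto
    qed
    moreover have "(w, x) \<in> parcs G" if "x \<in> U" "x \<noteq> u" for x
    proof -
      have "{w, x} \<notin> M" using uniq[of "{w, x}"] uw that by (auto simp: doubleton_eq_iff)
      then show ?thesis using uw that arcs by auto
    qed
    moreover have "(u, w) \<notin> parcs G" "(w, u) \<notin> parcs G"
      using T uw arcs by (auto simp: insert_commute)
    moreover have "u \<noteq> w" using uw UW(3) by blast
    ultimately show "T \<in> mis_sets (pverts G) (parcs G) 2"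
      using uw UW(6) irrefl by (auto simp: mis_sets_def mis_def)
  qed
  then have "n div 2 \<le> card (mis_sets (pverts G) (parcs G) 2)"
    using M(2) card_mono[OF finite_mis_sets[OF G(3)]] by metis
  moreover have "card (mis_sets (pverts G) (parcs G) 2) \<le> n div 2"
    using card_mis_pairs_le[OF G(3)] G(2) assms(2) by simp
  ultimately show ?thesis using G(5) by simp
qed

section \<open>Bounds on \<open>m3\<close> and the constructions for the lower bounds\<close>

lemma num_mis_le_2_power:
  assumes "triangle_free_graph n G"
  shows "num_mis G k \<le> 2 ^ n"
proof -
  note G = triangle_free_graphD[OF assms]
  have "mis_sets (pverts G) (parcs G) k \<subseteq> Pow (pverts G)"
    by (auto simp: mis_sets_def mis_def)
  then have "card (mis_sets (pverts G) (parcs G) k) \<le> 2 ^ n"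
    using card_mono[of "Pow (pverts G)"] G(2,3) by (fastforce simp: card_Pow)
  then show ?thesis by (simp add: G(5))
qed

lemma num_mis_le_m3:
  assumes "triangle_free_graph n (G :: nat pair_pre_digraph)"
  shows "num_mis G k \<le> m3 n k"
  unfolding m3_def
proof (rule Max_ge)
  show "finite {num_mis G k |G :: nat pair_pre_digraph. triangle_free_graph n G}"
    by (rule finite_subset[of _ "{..2 ^ n}"]) (auto intro: num_mis_le_2_power)
qed (use assms in blast)

text \<open>The second part is an isolated vertex for \<open>p = n - 1\<close>, and a comatching for even \<open>p\<close>.\<close>

definition double_comatching :: "nat \<Rightarrow> nat \<Rightarrow> nat pair_pre_digraph" where
  "double_comatching n p = \<lparr> pverts = {..<n}, parcs =
     {(i, j). i < n \<and> j < n \<and> (i < p \<longleftrightarrow> j < p) \<and> comatched i j} \<rparr>"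

lemma double_comatching_triangle_free_graph:
  "triangle_free_graph n (double_comatching n p)"
proof -
  let ?G = "double_comatching n p"
  have "pair_graph ?G"
  proof
    show "finite (pverts ?G)" by (simp add: double_comatching_def comatched_def)
    show "finite (parcs ?G)"
      by (rule finite_subset[of _ "{..<n} \<times> {..<n}"]) (auto simp: double_comatching_def comatched_def)
    show "symmetric (with_proj ?G)"
      by (auto simp: symmetric_def double_comatching_def comatched_def intro!: symI)
  qed (auto simp: double_comatching_def comatched_def)
  then show ?thesis
    by (auto simp: triangle_free_graph_def triangle_free_def double_comatching_def comatched_def)
qed

lemma m3_le:
  assumes "\<And>G :: nat pair_pre_digraph. triangle_free_graph n G \<Longrightarrow> num_mis G k \<le> b"
  shows "m3 n k \<le> b"
  unfolding m3_def
proof (rule Max.boundedI)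
  show "finite {num_mis G k |G :: nat pair_pre_digraph. triangle_free_graph n G}"
    by (rule finite_subset[of _ "{..2 ^ n}"]) (auto intro: num_mis_le_2_power)
  show "{num_mis G k |G :: nat pair_pre_digraph. triangle_free_graph n G} \<noteq> {}"
    using double_comatching_triangle_free_graph by blast
qed (use assms in blast)

text \<open>The last vertex \<open>p\<close> is isolated, so it belongs to every maximal independent
  set; each removed pair of the comatching on the first \<open>p\<close> vertices completes it to a
  set of size 3.\<close>

lemma m3_triples_lower: "(n - 1) div 2 \<le> m3 n 3"
proof (cases n)
  case (Suc p)
  let ?G = "double_comatching n p"
  let ?S = "\<lambda>i. {2 * i, 2 * i + 1, p}"
  note G = triangle_free_graphD[OF double_comatching_triangle_free_graph[of n p]]
  have "?S ` {..<p div 2} \<subseteq> mis_sets (pverts ?G) (parcs ?G) 3"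
  proof
    fix T assume "T \<in> ?S ` {..<p div 2}"
    then obtain i where i: "i < p div 2" and T: "T = ?S i" by blast
    have "\<exists>u\<in>T. (u, w) \<in> parcs ?G" if "w \<in> pverts ?G - T" for w
    proof -
      have w: "w < p" "w \<noteq> 2 * i" "w \<noteq> 2 * i + 1"
        using that unfolding T Suc by (auto simp: double_comatching_def comatched_def)
      \<comment> \<open>Pair \<open>i\<close> has a vertex of either parity; the one of parity
        opposite to \<open>w\<close> is adjacent to \<open>w\<close>.\<close>
      then have "w div 2 \<noteq> i" by presburger
      then show ?thesis
        using w i unfolding T Suc by (cases "even w") (auto simp: double_comatching_def comatched_def)
    qed
    then show "T \<in> mis_sets (pverts ?G) (parcs ?G) 3"
      using i unfolding T Suc mis_sets_def mis_def by (auto simp: double_comatching_def comatched_def)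
  qed
  then have "card (?S ` {..<p div 2}) \<le> num_mis ?G 3"
    unfolding G(5) by (intro card_mono finite_mis_sets G(3))
  moreover have "inj_on ?S {..<p div 2}"
  proof (rule inj_onI)
    fix i j assume ij: "i \<in> {..<p div 2}" "j \<in> {..<p div 2}" "?S i = ?S j"
    then have "2 * i \<in> ?S j" "2 * j \<in> ?S i" by blast+
    then show "i = j" using ij(1,2) by (auto; presburger)
  qed
  ultimately have "p div 2 \<le> num_mis ?G 3" by (simp add: card_image)
  then show ?thesis
    using num_mis_le_m3[OF double_comatching_triangle_free_graph, of n p 3] Suc by simp
qed simp

text \<open>One removed pair is chosen in each of the two parts, with \<open>q\<close> candidates on
  either side. The boundary \<open>2 * q\<close> is even, so it splits no pair, and the at most
  three vertices beyond \<open>4 * q\<close> are dominated by the pair from the second part.\<close>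

lemma m3_quadruples_lower: "(n div 4)\<^sup>2 \<le> m3 n 4"
proof -
  define q where "q = n div 4"
  let ?G = "double_comatching n (2 * q)"
  let ?S = "\<lambda>(i, j). {2 * i, 2 * i + 1, 2 * (q + j), 2 * (q + j) + 1}"
  note G = triangle_free_graphD[OF double_comatching_triangle_free_graph[of n "2 * q"]]
  have q: "4 * q \<le> n" by (simp add: q_def)
  have "?S ` ({..<q} \<times> {..<q}) \<subseteq> mis_sets (pverts ?G) (parcs ?G) 4"
  proof
    fix T assume "T \<in> ?S ` ({..<q} \<times> {..<q})"
    then obtain i j where ij: "i < q" "j < q" and T: "T = ?S (i, j)" by blast
    have "\<exists>u\<in>T. (u, w) \<in> parcs ?G" if "w \<in> pverts ?G - T" for w
    proof -
      have w: "w < n" "w \<noteq> 2 * i" "w \<noteq> 2 * i + 1" "w \<noteq> 2 * (q + j)" "w \<noteq> 2 * (q + j) + 1"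
        using that unfolding T by (auto simp: double_comatching_def comatched_def)
      have "w div 2 \<noteq> i" using w(2,3) by presburger
      moreover have "w div 2 \<noteq> q + j" using w(4,5) by presburger
      moreover have adj: "\<exists>u\<in>{2 * k, 2 * k + 1}. (u, w) \<in> parcs ?G"
        if k: "w div 2 \<noteq> k" "w < 2 * q \<longleftrightarrow> k < q" "2 * k + 1 < n" for k
      proof -
        have "(if even w then 2 * k + 1 else 2 * k, w) \<in> parcs ?G"
          using k w(1) unfolding double_comatching_def comatched_def by auto
        then show ?thesis by (auto split: if_splits)
      qed
      moreover have "2 * i + 1 < n" using ij q by linarith
      moreover have "2 * (q + j) + 1 < n" using ij q by simp
      ultimately show ?thesis
        using adj[of i] adj[of "q + j"] ij unfolding T by (cases "w < 2 * q") auto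
    qed
    moreover have "T \<subseteq> pverts ?G" "\<forall>u\<in>T. \<forall>v\<in>T. (u, v) \<notin> parcs ?G"
      using ij q unfolding T by (auto simp: double_comatching_def comatched_def)
    moreover have "card T = 4"
    proof -
      have "2 * i \<noteq> 2 * (q + j) + 1" "2 * i + 1 \<noteq> 2 * (q + j)"
        by (metis dvd_triv_left even_plus_one_iff)+
      then show ?thesis using ij unfolding T by (simp add: card_insert_if)
    qed
    ultimately show "T \<in> mis_sets (pverts ?G) (parcs ?G) 4"
      by (auto simp: mis_sets_def mis_def)
  qed
  then have "card (?S ` ({..<q} \<times> {..<q})) \<le> num_mis ?G 4"
    unfolding G(5) by (intro card_mono finite_mis_sets G(3))
  moreover have "inj_on ?S ({..<q} \<times> {..<q})"
  proof (rule inj_onI)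
    fix x y assume xy: "x \<in> {..<q} \<times> {..<q}" "y \<in> {..<q} \<times> {..<q}" "?S x = ?S y"
    then obtain i j i' j' where x: "x = (i, j)" and y: "y = (i', j')"
      and ij: "i < q" "j < q" "i' < q" "j' < q"
      by auto
    have "?S (i, j) = ?S (i', j')" using xy(3) unfolding x y .
    then have "2 * i \<in> ?S (i', j')" "2 * (q + j) \<in> ?S (i', j')" by blast+
    then have "2 * i = 2 * i' \<or> 2 * i = 2 * i' + 1 \<or> 2 * i = 2 * (q + j') \<or> 2 * i = 2 * (q + j') + 1"
      "2 * (q + j) = 2 * i' \<or> 2 * (q + j) = 2 * i' + 1 \<or>
       2 * (q + j) = 2 * (q + j') \<or> 2 * (q + j) = 2 * (q + j') + 1"
      by simp_all
    then have "i = i' \<or> i = q + j'" "q + j = i' \<or> j = j'" by presburger+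
    then show "x = y" using ij x y by auto
  qed
  ultimately have "q * q \<le> num_mis ?G 4" by (simp add: card_image)
  then show ?thesis
    using num_mis_le_m3[OF double_comatching_triangle_free_graph, of n "2 * q" 4]
    by (simp add: q_def power2_eq_square)
qed

section \<open>Growth rates for sizes three and four\<close>

lemma m3_triples_upper: "m3 n 3 \<le> 10 * n"
proof (rule m3_le)
  fix G :: "nat pair_pre_digraph" assume "triangle_free_graph n G"
  note G = triangle_free_graphD[OF this]
  show "num_mis G 3 \<le> 10 * n"
    using triangle_free_rel.card_mis_triples_le[OF G(4,3)] by (simp add: G(2,5))
qed

lemma m3_quadruples_upper: "m3 n 4 \<le> 10 * n\<^sup>2"
proof (rule m3_le)
  fix G :: "nat pair_pre_digraph" assume "triangle_free_graph n G"
  note G = triangle_free_graphD[OF this]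
  show "num_mis G 4 \<le> 10 * n\<^sup>2"
    using triangle_free_rel.card_mis_quadruples_le[OF G(4,3)] by (simp add: G(2,5))
qed

lemma m3_triples_bigtheta: "(\<lambda>n. real (m3 n 3)) \<in> \<Theta>(\<lambda>n. real n)"
proof
  show "(\<lambda>n. real (m3 n 3)) \<in> O(\<lambda>n. real n)"
  proof (rule bigoI[where c = 10], rule always_eventually, rule allI)
    fix n
    have "real (m3 n 3) \<le> real (10 * n)"
      using m3_triples_upper[of n] of_nat_le_iff by blast
    then show "norm (real (m3 n 3)) \<le> 10 * norm (real n)" by simp
  qed
  show "(\<lambda>n. real (m3 n 3)) \<in> \<Omega>(\<lambda>n. real n)"
    unfolding bigomega_iff_bigo
  \<comment> \<open>From \<open>n = 4\<close> on, \<open>(n - 1) div 2\<close> is at least n/4, with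
    equality at 4.\<close>
  proof (rule bigoI[where c = 4], rule eventually_sequentiallyI[of 4])
    fix n :: nat assume "4 \<le> n"
    then have "n \<le> 4 * ((n - 1) div 2)" by presburger
    then have "n \<le> 4 * m3 n 3" using m3_triples_lower[of n] by linarith
    then have "real n \<le> real (4 * m3 n 3)" using of_nat_le_iff by blast
    then show "norm (real n) \<le> 4 * norm (real (m3 n 3))" by simp
  qed
qed

lemma m3_quadruples_bigtheta: "(\<lambda>n. real (m3 n 4)) \<in> \<Theta>(\<lambda>n. real n ^ 2)"
proof
  show "(\<lambda>n. real (m3 n 4)) \<in> O(\<lambda>n. real n ^ 2)"
  proof (rule bigoI[where c = 10], rule always_eventually, rule allI)
    fix n
    have "real (m3 n 4) \<le> real (10 * n\<^sup>2)"
      using m3_quadruples_upper[of n] of_nat_le_iff by blast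
    then show "norm (real (m3 n 4)) \<le> 10 * norm (real n ^ 2)" by simp
  qed
  show "(\<lambda>n. real (m3 n 4)) \<in> \<Omega>(\<lambda>n. real n ^ 2)"
    unfolding bigomega_iff_bigo
  \<comment> \<open>From \<open>n = 4\<close> on, \<open>n div 4\<close> is at least n/8, and 64 is
    the square of 8.\<close>
  proof (rule bigoI[where c = 64], rule eventually_sequentiallyI[of 4])
    fix n :: nat assume "4 \<le> n"
    then have "n \<le> 8 * (n div 4)" by presburger
    then have "n\<^sup>2 \<le> (8 * (n div 4))\<^sup>2" by (rule power_mono) simp
    also have "\<dots> \<le> 64 * m3 n 4"
      using m3_quadruples_lower[of n] by (simp add: power_mult_distrib)
    finally have "real (n\<^sup>2) \<le> real (64 * m3 n 4)" using of_nat_le_iff by blast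
    then show "norm (real n ^ 2) \<le> 64 * norm (real (m3 n 4))" by simp
  qed
qed

section \<open>Size two: extremal value and uniqueness\<close>

lemma m3_pairs:
  assumes "8 \<le> n"
  shows "m3 n 2 = n div 2"
proof (rule antisym)
  show "m3 n 2 \<le> n div 2"
  proof (rule m3_le)
    fix G :: "nat pair_pre_digraph" assume "triangle_free_graph n G"
    note G = triangle_free_graphD[OF this]
    show "num_mis G 2 \<le> n div 2"
      using triangle_free_rel.card_mis_pairs_le[OF G(4,3)] assms by (simp add: G(2,5))
  qed
  \<comment> \<open>With \<open>p = n\<close> the second part is empty, so this is the standard
    comatching with the identity as labelling.\<close>
  let ?G = "double_comatching n n"
  have "comatching_labelling n (pverts ?G) (parcs ?G) id"
    by (auto simp: comatching_labelling_def double_comatching_def comatched_def)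
  then have "comatching n ?G"
    using comatching_labelling_imp_comatching
      triangle_free_graphD(1)[OF double_comatching_triangle_free_graph] by blast
  then show "n div 2 \<le> m3 n 2"
    using num_mis_le_m3[OF double_comatching_triangle_free_graph, of n n 2]
      comatching_num_mis[of n ?G] assms by simp
qed

lemma extremal_graph_labelling:
  assumes "triangle_free_graph n G" "num_mis G 2 = n div 2" "8 \<le> n"
  shows "\<exists>g. comatching_labelling n (pverts G) (parcs G) g"
proof -
  note G = triangle_free_graphD[OF assms(1)]
  show ?thesis
    using triangle_free_rel.extremal_comatching_labelling[OF G(4,3)] G(2,5) assms(2,3) by simp
qed

lemma extremal_iff_comatching:
  assumes "8 \<le> n"
  shows "triangle_free_graph n G \<and> num_mis G 2 = n div 2 \<longleftrightarrow> comatching n G"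
  using extremal_graph_labelling[OF _ _ assms] comatching_labelling_imp_comatching
    triangle_free_graphD(1) comatching_imp_triangle_free_graph comatching_num_mis[OF _ assms]
  by metis

lemma extremal_graphs_iso:
  assumes "8 \<le> n"
    and G: "triangle_free_graph n G" "num_mis G 2 = n div 2"
    and H: "triangle_free_graph n H" "num_mis H 2 = n div 2"
  shows "digraph_iso (with_proj G) (with_proj H)"
proof -
  obtain g h where "comatching_labelling n (pverts G) (parcs G) g"
    "comatching_labelling n (pverts H) (parcs H) h"
    using extremal_graph_labelling G H assms(1) by meson
  then show ?thesis
    by (rule comatching_labelling_iso[OF triangle_free_graphD(1)[OF G(1)] triangle_free_graphD(1)[OF H(1)]])
qed

theorem theorem1p6:
  shows "(\<forall>n\<ge>8. m3 n 2 = n div 2 \<and>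
            (\<forall>G :: 'a pair_pre_digraph.
               triangle_free_graph n G \<and> num_mis G 2 = n div 2 \<longleftrightarrow> comatching n G) \<and>
            (\<forall>(G :: 'a pair_pre_digraph) (H :: 'b pair_pre_digraph).
               triangle_free_graph n G \<and> num_mis G 2 = n div 2 \<and>
               triangle_free_graph n H \<and> num_mis H 2 = n div 2 \<longrightarrow>
               digraph_iso (with_proj G) (with_proj H))) \<and>
         (\<lambda>n. real (m3 n 3)) \<in> \<Theta>(\<lambda>n. real n) \<and>
         (\<lambda>n. real (m3 n 4)) \<in> \<Theta>(\<lambda>n. real n ^ 2)"
proof (intro conjI)
  show "\<forall>n\<ge>8. m3 n 2 = n div 2 \<and>
            (\<forall>G :: 'a pair_pre_digraph.
               triangle_free_graph n G \<and> num_mis G 2 = n div 2 \<longleftrightarrow> comatching n G) \<and>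
            (\<forall>(G :: 'a pair_pre_digraph) (H :: 'b pair_pre_digraph).
               triangle_free_graph n G \<and> num_mis G 2 = n div 2 \<and>
               triangle_free_graph n H \<and> num_mis H 2 = n div 2 \<longrightarrow>
               digraph_iso (with_proj G) (with_proj H))"
    using m3_pairs extremal_iff_comatching extremal_graphs_iso by blast
qed (rule m3_triples_bigtheta m3_quadruples_bigtheta)+

end
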